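(* Let $q$ be any prime power, and let $\theta$ be a generator of the multiplicative group of $\mathbb{F}_{q^3}$. If $\mathcal{K}\subseteq\mathbb{F}_q\times\mathbb{F}_q$ does not contain two pairs with one an $\mathbb{F}_q$-multiple of the other, then $\mathrm{Singer}(q,\theta,\mathcal{K})$ is a subset of $\mathbb{Z}_{q^2+q+1}$ with $|\mathcal{K}|\,q+1$ elements, and $$\|\mathrm{Singer}(q,\theta,\mathcal{K})\ast\mathrm{Singer}(q,\theta,\mathcal{K})\|_\infty\le 2|\mathcal{K}|^2.$$
   Context: $[n]=\{1,\dots,n\}$, $\mathbb{Z}_n$ denotes the integers modulo $n$, and $\mathbb{F}_q$ is the finite field with $q$ elements, regarded as a subfield of $\mathbb{F}_{q^3}$. For $S\subseteq\mathbb{Z}_n$ and $m\in\mathbb{Z}_n$, let $S\ast S(m)=|\{(s_1,s_2): s_1,s_2\in S,\ s_1+s_2=m\}|$ (ordered pairs, addition in $\mathbb{Z}_n$), and $\|S\ast S\|_\infty=\max_{m\in\mathbb{Z}_n}S\ast S(m)$. For each $k_1,k_2\in\mathbb{F}_q$ define $T(\langle k_1,k_2\rangle)=\{0\}\cup\{a\in[q^3-1] : \theta^a-k_2\theta^2-k_1\theta\in\mathbb{F}_q\}$, and let $\mathrm{Singer}(q,\theta,\langle k_1,k_2\rangle)\subseteq\mathbb{Z}_{q^2+q+1}$ be the set of congruence classes modulo $q^2+q+1$ that intersect $T(\langle k_1,k_2\rangle)$. For $\mathcal{K}\subseteq\mathbb{F}_q\times\mathbb{F}_q$ set $\mathrm{Singer}(q,\theta,\mathcal{K})=\bigcup_{\vec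 k\in\mathcal{K}}\mathrm{Singer}(q,\theta,\vec k)$.
   Formalization: The claim that Singer(q,θ,K) has |K|q+1 elements is made only for K nonempty and K ≠ {(0,0)}; in those two cases the set has 0 and 1 elements respectively, so the printed count fails. The inclusion and the bound 2|K|² hold for all K. *)

theory Defs
  imports
    "HOL-Algebra.Subrings"
    "HOL-Number_Theory.Residues"
    "HOL-Number_Theory.Prime_Powers"
begin

(* Z_n is the library ring residue_ring n, whose carrier is {0..n - 1}. *)

definition self_conv :: "nat \<Rightarrow> int set \<Rightarrow> int \<Rightarrow> nat" where
  "self_conv n S m =
     card {(s1, s2). s1 \<in> S \<and> s2 \<in> S \<and> s1 \<oplus>\<^bsub>residue_ring (int n)\<^esub> s2 = m}"

definition self_conv_sup_norm :: "nat \<Rightarrow> int set \<Rightarrow> nat" where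
  "self_conv_sup_norm n S = Max (self_conv n S ` carrier (residue_ring (int n)))"

(* In the following, L plays the role of the field with q^3 elements and F that of
   its subfield with q elements. *)

definition Singer_exponents ::
  "('a, 'b) ring_scheme \<Rightarrow> 'a set \<Rightarrow> nat \<Rightarrow> 'a \<Rightarrow> 'a \<times> 'a \<Rightarrow> nat set" where
  "Singer_exponents L F q \<theta> = (\<lambda>(k1, k2).
     {0} \<union> {a \<in> {1..q ^ 3 - 1}.
       \<theta> [^]\<^bsub>L\<^esub> a \<ominus>\<^bsub>L\<^esub> k2 \<otimes>\<^bsub>L\<^esub> (\<theta> [^]\<^bsub>L\<^esub> (2::nat)) \<ominus>\<^bsub>L\<^esub> k1 \<otimes>\<^bsub>L\<^esub> \<theta> \<in> F})"

(* A congruence class is represented by its unique member in {0..q^2 + q}. *)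

definition Singer_single ::
  "('a, 'b) ring_scheme \<Rightarrow> 'a set \<Rightarrow> nat \<Rightarrow> 'a \<Rightarrow> 'a \<times> 'a \<Rightarrow> int set" where
  "Singer_single L F q \<theta> k =
     {m \<in> carrier (residue_ring (int (q\<^sup>2 + q + 1))).
       \<exists>a \<in> Singer_exponents L F q \<theta> k. [int a = m] (mod int (q\<^sup>2 + q + 1))}"

definition Singer ::
  "('a, 'b) ring_scheme \<Rightarrow> 'a set \<Rightarrow> nat \<Rightarrow> 'a \<Rightarrow> ('a \<times> 'a) set \<Rightarrow> int set" where
  "Singer L F q \<theta> \<K> = (\<Union>k\<in>\<K>. Singer_single L F q \<theta> k)"

end

theory Submission
  imports Defs "HOL-Algebra.Multiplicative_Group"
begin

text \<open>
  Two nonzero elements of \<open>L\<close> are called proportional if they differ by a factor in \<open>F\<close>. Since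
  \<open>\<theta> ^ a \<in> F\<close> exactly when \<open>q\<^sup>2 + q + 1\<close> divides \<open>a\<close> (\<open>theta_pow_in_F\<close>), the discrete logarithm
  modulo \<open>q\<^sup>2 + q + 1\<close> identifies proportionality classes with residues and turns products into
  sums (\<open>dlog_eq_iff\<close>, \<open>dlog_mult\<close>). With \<open>v\<^sub>k = k\<^sub>2 \<theta>\<^sup>2 + k\<^sub>1 \<theta>\<close>, the Singer set of \<open>k\<close> then consists
  of the classes of \<open>1\<close> and of the nonzero \<open>v\<^sub>k + u\<close> with \<open>u \<in> F\<close>, all of which lie in the subspace
  \<open>F + F v\<^sub>k\<close> (\<open>Singer_single_eq\<close>, \<open>Singer_single_plane\<close>).

  The one fact about the extension is \<open>quadratic_relation\<close>: an element \<open>t\<close> outside \<open>F\<close> satisfies no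
  nontrivial quadratic equation over \<open>F\<close>. Otherwise \<open>F + F t\<close> would be closed under multiplication,
  its nonzero elements would form a subgroup of order \<open>q\<^sup>2 - 1\<close>, and \<open>q\<^sup>2 - 1\<close> would divide \<open>q\<^sup>3 - 1\<close>.

  Cardinality: a proportionality between \<open>v\<^sub>k + u\<close> and \<open>v\<^sub>l + u'\<close> is a quadratic relation for \<open>\<theta>\<close>, so
  it makes \<open>k\<close> a multiple of \<open>l\<close>, hence \<open>k = l\<close> and \<open>u = u'\<close> (\<open>card_Singer\<close>).

  Convolution: it suffices that for fixed \<open>k\<close> and \<open>l\<close> every residue has at most two representations
  as a sum over the two Singer sets (\<open>card_Singer_pairs_le_2\<close>), because there are \<open>card \<K>\<^sup>2\<close> pairs
  \<open>(k, l)\<close>. A representation is a factorization \<open>w = x y\<close> of a fixed \<open>w\<close> with \<open>x \<in> F + F v\<^sub>k\<close> and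
  \<open>y \<in> F + F v\<^sub>l\<close>. Three factorizations with pairwise nonproportional \<open>x\<^sub>1, x\<^sub>2, x\<^sub>3\<close> cannot exist
  (\<open>no_three_factorizations\<close>): both spaces are at most two-dimensional, so \<open>x\<^sub>3 = p x\<^sub>1 + r x\<^sub>2\<close> and
  \<open>y\<^sub>3 = \<alpha> y\<^sub>2 + \<beta> y\<^sub>1\<close>, and expanding \<open>x\<^sub>3 y\<^sub>3 = w\<close> gives a quadratic equation over \<open>F\<close> for
  \<open>t = x\<^sub>1 / x\<^sub>2\<close>, which lies outside \<open>F\<close>. All its coefficients vanish, which forces \<open>y\<^sub>3 = 0\<close>.
\<close>

section \<open>Finite groups\<close>

lemma (in group) finite_closed_subset_subgroup:
  assumes "finite (carrier G)" and "H \<subseteq> carrier G" and "H \<noteq> {}"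
    and closed: "\<And>a b. a \<in> H \<Longrightarrow> b \<in> H \<Longrightarrow> a \<otimes> b \<in> H"
  shows "subgroup H G"
proof (rule subgroupI)
  fix a assume a: "a \<in> H"
  then have aG: "a \<in> carrier G" using assms(2) by blast
  have pow: "a [^] Suc k \<in> H" for k
    using a aG by (induction k) (auto intro: closed)
  \<comment> \<open>The inverse is \<open>a ^ (2 order G - 1)\<close>; the exponent is positive even in the trivial group.\<close>
  define m where "m = order G + (order G - 1)"
  have pos: "order G > 0" using assms(1) by (simp add: order_gt_0_iff_finite)
  have "a [^] m \<otimes> a = a [^] Suc m" by simp
  also have "Suc m = order G + order G" using pos by (simp add: m_def)
  also have "a [^] (order G + order G) = \<one>"
    using aG by (simp add: nat_pow_mult [symmetric] pow_order_eq_1)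
  finally have "inv a = a [^] m" using aG by (simp add: inv_equality)
  moreover have "m = Suc (m - 1)" using pos by (simp add: m_def)
  ultimately show "inv a \<in> H" using pow[of "m - 1"] by simp
qed (use assms in auto)

lemma (in group) pow_card_subgroup:
  assumes "subgroup H G" and "x \<in> H"
  shows "x [^] card H = \<one>"
proof -
  interpret H: group "G\<lparr>carrier := H\<rparr>" using assms(1) by (rule subgroup_imp_group)
  show ?thesis
    using H.pow_order_eq_1[of x] assms(2) by (simp add: order_def nat_pow_consistent[symmetric])
qed

section \<open>Cubic extensions of finite fields\<close>

text \<open>A finite field \<open>L\<close> with \<open>q\<^sup>3\<close> elements and a subfield \<open>F\<close> with \<open>q\<close> elements. Positivity of \<open>q\<close>
  rules out infinite carriers, whose \<open>card\<close> is 0.\<close>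

locale finite_cubic_extension = field L for L (structure) +
  fixes F :: "'a set" and q :: nat
  assumes subfield: "subfield F L"
    and q_pos: "q > 0"
    and card_F: "card F = q"
    and card_L: "card (carrier L) = q ^ 3"
begin

lemmas F_subring = subringE[OF subfieldE(1)[OF subfield]]

lemma F_carrier [simp, intro]: "x \<in> F \<Longrightarrow> x \<in> carrier L"
  using F_subring(1) by blast

lemma F_closed [simp, intro]:
  "\<zero> \<in> F" "\<one> \<in> F" "x \<in> F \<Longrightarrow> \<ominus> x \<in> F"
  "x \<in> F \<Longrightarrow> y \<in> F \<Longrightarrow> x \<otimes> y \<in> F"
  "x \<in> F \<Longrightarrow> y \<in> F \<Longrightarrow> x \<oplus> y \<in> F"
  "x \<in> F \<Longrightarrow> y \<in> F \<Longrightarrow> x \<ominus> y \<in> F"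
  using F_subring by (auto simp: a_minus_def)

lemma F_inv [simp, intro]: "x \<in> F \<Longrightarrow> x \<noteq> \<zero> \<Longrightarrow> inv x \<in> F"
  using subfield_m_inv(1)[OF subfield, of x] by auto

lemma inv_nonzero [simp]:
  assumes "x \<in> carrier L" "x \<noteq> \<zero>"
  shows "inv x \<in> carrier L" "inv x \<otimes> x = \<one>" "x \<otimes> inv x = \<one>"
  using assms by (auto simp: field_Units)

text \<open>Rewriting to sorted sums of sorted monomials; it decides identities without cancellation.\<close>

lemmas expand = a_minus_def l_distr r_distr l_minus r_minus minus_add a_ac m_ac

lemma divide_left:
  assumes "x \<in> carrier L" "x \<noteq> \<zero>" "y \<in> carrier L" "x \<otimes> y = z"
  shows "y = inv x \<otimes> z"
  using assms by (simp add: m_assoc[symmetric] flip: assms(4))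

lemma finite_F: "finite F" and finite_L: "finite (carrier L)"
  using card_F card_L q_pos by (auto intro: card_ge_0_finite)

lemma q_ge_2: "q \<ge> 2"
proof -
  have "card {\<zero>, \<one>} \<le> card F" using finite_F by (intro card_mono) auto
  then show ?thesis using card_F by simp
qed

lemma linear_relation:
  assumes "t \<in> carrier L" "t \<notin> F" "b \<in> F" "c \<in> F" "b \<otimes> t \<oplus> c = \<zero>"
  shows "b = \<zero> \<and> c = \<zero>"
proof -
  note [simp, intro] = assms(1)
  have bc: "b \<in> carrier L" "c \<in> carrier L" using assms by auto
  have "b = \<zero>"
  proof (rule ccontr)
    assume b: "b \<noteq> \<zero>"
    have "b \<otimes> t = \<ominus> c" using assms bc by (intro sum_zero_eq_neg) auto
    then have "t = inv b \<otimes> \<ominus> c" using divide_left[of b t] b bc assms by simp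
    then show False using assms b by auto
  qed
  then show ?thesis using assms bc by simp
qed

lemma inj_on_combination:
  assumes "s \<in> carrier L" "t \<in> carrier L" "t \<noteq> \<zero>" and indep: "\<And>c. c \<in> F \<Longrightarrow> s \<noteq> c \<otimes> t"
  shows "inj_on (\<lambda>(x, y). x \<otimes> t \<oplus> y \<otimes> s) (F \<times> F)"
proof (rule inj_onI, clarify)
  fix x y x' y' assume F: "x \<in> F" "y \<in> F" "x' \<in> F" "y' \<in> F"
    and eq: "x \<otimes> t \<oplus> y \<otimes> s = x' \<otimes> t \<oplus> y' \<otimes> s"
  have car: "x \<in> carrier L" "y \<in> carrier L" "x' \<in> carrier L" "y' \<in> carrier L"
    using F by auto
  have "(y \<ominus> y') \<otimes> s \<oplus> (x \<ominus> x') \<otimes> t = (x \<otimes> t \<oplus> y \<otimes> s) \<ominus> (x' \<otimes> t \<oplus> y' \<otimes> s)"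
    using car assms by (simp add: expand)
  then have rel: "(y \<ominus> y') \<otimes> s \<oplus> (x \<ominus> x') \<otimes> t = \<zero>" using car assms by (simp add: eq)
  have y0: "y \<ominus> y' = \<zero>"
  proof (rule ccontr)
    assume nz: "y \<ominus> y' \<noteq> \<zero>"
    have "(y \<ominus> y') \<otimes> s = \<ominus> ((x \<ominus> x') \<otimes> t)"
      using rel car assms by (intro sum_zero_eq_neg) auto
    then have "s = inv (y \<ominus> y') \<otimes> \<ominus> ((x \<ominus> x') \<otimes> t)"
      using divide_left[of "y \<ominus> y'" s] nz car assms by simp
    also have "\<dots> = (inv (y \<ominus> y') \<otimes> \<ominus> (x \<ominus> x')) \<otimes> t"
      using nz car assms by (simp add: l_minus m_assoc)
    finally show False using indep[of "inv (y \<ominus> y') \<otimes> \<ominus> (x \<ominus> x')"] nz F by auto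
  qed
  have "(x \<ominus> x') \<otimes> t = \<zero>" using rel car assms unfolding y0 by simp
  then have "x \<ominus> x' = \<zero>" using integral[of "x \<ominus> x'" t] car assms by blast
  then show "x = x' \<and> y = y'" using y0 car by simp
qed

text \<open>The subspace \<open>F + F v\<close>, a plane over \<open>F\<close> when \<open>v\<close> lies outside \<open>F\<close>. The degenerate
  case \<open>v \<in> F\<close>, where it equals \<open>F\<close>, is allowed.\<close>

definition plane :: "'a \<Rightarrow> 'a set" where
  "plane v = (\<lambda>(a, b). a \<oplus> b \<otimes> v) ` (F \<times> F)"

lemma planeI: "a \<in> F \<Longrightarrow> b \<in> F \<Longrightarrow> a \<oplus> b \<otimes> v \<in> plane v"
  by (force simp: plane_def)

lemma planeE:
  assumes "x \<in> plane v"
  obtains a b where "a \<in> F" "b \<in> F" "x = a \<oplus> b \<otimes> v"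
  using assms by (auto simp: plane_def)

lemma finite_plane: "finite (plane v)" and card_plane_le: "card (plane v) \<le> q\<^sup>2"
proof -
  have "card (plane v) \<le> card (F \<times> F)"
    unfolding plane_def using finite_F by (intro card_image_le) simp
  then show "card (plane v) \<le> q\<^sup>2" by (simp only: card_cartesian_product card_F power2_eq_square)
qed (simp add: plane_def finite_F)

lemma plane_carrier: "v \<in> carrier L \<Longrightarrow> x \<in> plane v \<Longrightarrow> x \<in> carrier L"
  by (auto elim!: planeE)

lemma plane_combination_closed:
  assumes v: "v \<in> carrier L" and "c \<in> F" "d \<in> F" "x \<in> plane v" "y \<in> plane v"
  shows "c \<otimes> x \<oplus> d \<otimes> y \<in> plane v"
proof -
  obtain a b where ab: "a \<in> F" "b \<in> F" "x = a \<oplus> b \<otimes> v" using assms(4) by (rule planeE)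
  obtain a' b' where ab': "a' \<in> F" "b' \<in> F" "y = a' \<oplus> b' \<otimes> v" using assms(5) by (rule planeE)
  have "c \<otimes> (a \<oplus> b \<otimes> v) \<oplus> d \<otimes> (a' \<oplus> b' \<otimes> v) =
      (c \<otimes> a \<oplus> d \<otimes> a') \<oplus> (c \<otimes> b \<oplus> d \<otimes> b') \<otimes> v"
    using assms ab(1,2) ab'(1,2) by (simp add: expand)
  then show ?thesis using assms ab ab' by (auto intro: planeI)
qed

lemma plane_scale:
  assumes "v \<in> carrier L" "c \<in> F" "x \<in> plane v"
  shows "c \<otimes> x \<in> plane v"
  using plane_combination_closed[OF assms(1,2) F_closed(1) assms(3,3)] plane_carrier assms by simp

text \<open>Two nonproportional vectors span: their \<open>q\<^sup>2\<close> combinations are distinct and lie in a set of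
  at most \<open>q\<^sup>2\<close> elements.\<close>

lemma plane_combination:
  assumes v: "v \<in> carrier L" and x: "x1 \<in> plane v" "x2 \<in> plane v" "x3 \<in> plane v"
    and nz: "x2 \<noteq> \<zero>" and indep: "\<And>c. c \<in> F \<Longrightarrow> x1 \<noteq> c \<otimes> x2"
  obtains p r where "p \<in> F" "r \<in> F" "x3 = p \<otimes> x1 \<oplus> r \<otimes> x2"
proof -
  have car: "x1 \<in> carrier L" "x2 \<in> carrier L" using plane_carrier v x by auto
  define h where "h = (\<lambda>(r, p). r \<otimes> x2 \<oplus> p \<otimes> x1)"
  have "card (h ` (F \<times> F)) = q\<^sup>2"
    unfolding h_def using inj_on_combination[OF car nz indep]
    by (simp only: card_image card_cartesian_product card_F power2_eq_square)
  moreover have "h ` (F \<times> F) \<subseteq> plane v"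
    using plane_combination_closed[OF v _ _ x(2,1)] by (auto simp: h_def)
  ultimately have "h ` (F \<times> F) = plane v"
    using card_plane_le finite_plane by (intro card_seteq) auto
  then obtain r p where "r \<in> F" "p \<in> F" "x3 = h (r, p)" using x(3) by blast
  then show ?thesis using that[of p r] car by (simp add: h_def a_comm)
qed

lemma card_plane:
  assumes "t \<in> carrier L" "t \<notin> F"
  shows "card (plane t) = q\<^sup>2"
proof -
  have "inj_on (\<lambda>(x, y). x \<otimes> \<one> \<oplus> y \<otimes> t) (F \<times> F)"
    using assms by (intro inj_on_combination) auto
  moreover have "plane t = (\<lambda>(x, y). x \<otimes> \<one> \<oplus> y \<otimes> t) ` (F \<times> F)"
    unfolding plane_def by (intro image_cong) auto
  ultimately show ?thesis
    by (simp only: card_image card_cartesian_product card_F power2_eq_square)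
qed

lemma quadratic_relation:
  assumes t: "t \<in> carrier L" "t \<notin> F" and abc: "a \<in> F" "b \<in> F" "c \<in> F"
    and rel: "a \<otimes> (t \<otimes> t) \<oplus> b \<otimes> t \<oplus> c = \<zero>"
  shows "a = \<zero> \<and> b = \<zero> \<and> c = \<zero>"
proof (cases "a = \<zero>")
  case True
  then show ?thesis using assms linear_relation[of t b c] by auto
next
  case False
  have car: "a \<in> carrier L" "b \<in> carrier L" "c \<in> carrier L" using abc by auto
  define e f where "e = inv a \<otimes> \<ominus> c" and "f = inv a \<otimes> \<ominus> b"
  have ef: "e \<in> F" "f \<in> F" using abc False by (auto simp: e_def f_def)
  have "a \<otimes> (t \<otimes> t) \<oplus> (b \<otimes> t \<oplus> c) = \<zero>" using rel car t by (simp add: a_assoc)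
  then have "a \<otimes> (t \<otimes> t) = \<ominus> (b \<otimes> t \<oplus> c)" using car t by (intro sum_zero_eq_neg) auto
  then have "t \<otimes> t = inv a \<otimes> \<ominus> (b \<otimes> t \<oplus> c)" using divide_left False car t by simp
  also have "\<dots> = e \<oplus> f \<otimes> t" using car t False by (simp add: e_def f_def expand)
  finally have tt: "t \<otimes> t = e \<oplus> f \<otimes> t" .
  define M where "M = plane t"
  have card_M: "card M = q\<^sup>2" using card_plane t by (simp add: M_def)
  have finM: "finite M" by (simp add: M_def finite_plane)
  have MI: "x \<oplus> y \<otimes> t \<in> M" if "x \<in> F" "y \<in> F" for x y
    using that by (simp add: M_def planeI)
  have M1: "\<one> \<in> M" "\<zero> \<in> M" using MI[of \<one> \<zero>] MI[of \<zero> \<zero>] t by auto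
  interpret G: group "mult_of L" by (rule field_mult_group)
  \<comment> \<open>Since \<open>t\<^sup>2 = e + f t\<close>, the plane \<open>F + F t\<close> is closed under multiplication.\<close>
  have "subgroup (M - {\<zero>}) (mult_of L)"
  proof (rule G.finite_closed_subset_subgroup)
    show "finite (carrier (mult_of L))" using finite_L by simp
    show "M - {\<zero>} \<subseteq> carrier (mult_of L)" using plane_carrier t by (auto simp: M_def)
    show "M - {\<zero>} \<noteq> {}" using M1 by (auto intro!: exI[of _ \<one>])
    fix m m' assume m: "m \<in> M - {\<zero>}" "m' \<in> M - {\<zero>}"
    then obtain x y x' y' where F: "x \<in> F" "y \<in> F" "x' \<in> F" "y' \<in> F"
      and mm: "m = x \<oplus> y \<otimes> t" "m' = x' \<oplus> y' \<otimes> t"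
      unfolding M_def by (auto elim!: planeE)
    have car: "x \<in> carrier L" "y \<in> carrier L" "x' \<in> carrier L" "y' \<in> carrier L"
       "e \<in> carrier L" "f \<in> carrier L"
      using F ef by auto
    have "m \<otimes> m' = x \<otimes> x' \<oplus> (x \<otimes> y' \<oplus> y \<otimes> x') \<otimes> t \<oplus> (y \<otimes> y') \<otimes> (t \<otimes> t)"
      using car t by (simp add: mm expand)
    also have "\<dots> = (x \<otimes> x' \<oplus> y \<otimes> y' \<otimes> e) \<oplus> (x \<otimes> y' \<oplus> y \<otimes> x' \<oplus> y \<otimes> y' \<otimes> f) \<otimes> t"
      unfolding tt using car t(1) by (simp add: expand)
    finally have "m \<otimes> m' \<in> M" using F ef by (auto intro: MI)
    moreover have "m \<otimes> m' \<noteq> \<zero>" using m mm car t integral[of m m'] by auto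
    ultimately show "m \<otimes>\<^bsub>mult_of L\<^esub> m' \<in> M - {\<zero>}" by simp
  qed
  from G.lagrange[OF this] have "card (M - {\<zero>}) dvd order (mult_of L)"
    by (metis dvd_triv_right)
  moreover have "card (M - {\<zero>}) = q\<^sup>2 - 1" using M1 finM card_M by simp
  moreover have "order (mult_of L) = q ^ 3 - 1"
    using finite_L card_L by (simp add: order_mult_of order_def)
  ultimately have dvd: "q\<^sup>2 - 1 dvd q ^ 3 - 1" by simp
  have q2: "q * q \<ge> 2 * q" using q_ge_2 by simp
  have "q ^ 3 - 1 = q * (q\<^sup>2 - 1) + (q - 1)"
  proof -
    obtain r where "q = Suc r" using q_pos by (cases q) auto
    then show ?thesis
      by (simp add: power2_eq_square power3_eq_cube algebra_simps)
  qed
  then have "q\<^sup>2 - 1 dvd q - 1" using dvd by (metis dvd_add_right_iff dvd_triv_right)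
  then have "q\<^sup>2 - 1 \<le> q - 1" using q_ge_2 by (intro dvd_imp_le) auto
  then have "q * q \<le> q" using q_pos unfolding power2_eq_square by linarith
  then have False using q2 q_ge_2 by linarith
  then show ?thesis ..
qed

text \<open>Up to proportionality an element has at most two factorizations with factors in two given
  planes. No relation between the planes is assumed; they may coincide or degenerate to \<open>F\<close>.\<close>

lemma no_three_factorizations:
  assumes v: "v \<in> carrier L" and u: "u \<in> carrier L" and w: "w \<in> carrier L" "w \<noteq> \<zero>"
    and x: "x1 \<in> plane v" "x2 \<in> plane v" "x3 \<in> plane v"
    and y: "y1 \<in> plane u" "y2 \<in> plane u" "y3 \<in> plane u"
    and xy: "x1 \<otimes> y1 = w" "x2 \<otimes> y2 = w" "x3 \<otimes> y3 = w"
    and indep: "\<And>c. c \<in> F \<Longrightarrow> x1 \<noteq> c \<otimes> x2" "\<And>c. c \<in> F \<Longrightarrow> x3 \<noteq> c \<otimes> x1"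
      "\<And>c. c \<in> F \<Longrightarrow> x3 \<noteq> c \<otimes> x2"
  shows False
proof -
  have car: "x1 \<in> carrier L" "x2 \<in> carrier L" "x3 \<in> carrier L"
    "y1 \<in> carrier L" "y2 \<in> carrier L" "y3 \<in> carrier L"
    using plane_carrier v u x y by auto
  have nz: "x1 \<noteq> \<zero>" "x2 \<noteq> \<zero>" "y1 \<noteq> \<zero>" "y2 \<noteq> \<zero>" "y3 \<noteq> \<zero>" using w xy car by auto
  obtain p r where pr: "p \<in> F" "r \<in> F" "x3 = p \<otimes> x1 \<oplus> r \<otimes> x2"
    using plane_combination[OF v x nz(2) indep(1)] by blast
  have pc: "p \<in> carrier L" "r \<in> carrier L" using pr by auto
  have pr0: "p \<noteq> \<zero>" "r \<noteq> \<zero>" using pr indep(2)[of p] indep(3)[of r] pc car by auto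
  define t where "t = x1 \<otimes> inv x2"
  have t: "t \<in> carrier L" using car nz by (simp add: t_def)
  have x1t: "x1 = t \<otimes> x2" using car nz by (simp add: t_def m_assoc)
  have tF: "t \<notin> F" using x1t indep(1) by auto
  have "x2 \<otimes> y2 = x2 \<otimes> (t \<otimes> y1)"
  proof -
    have "(t \<otimes> x2) \<otimes> y1 = x2 \<otimes> (t \<otimes> y1)"
      using t car by (simp add: m_ac)
    then show ?thesis using xy x1t by simp
  qed
  then have y2t: "y2 = t \<otimes> y1" using nz car t m_lcancel[of x2 y2 "t \<otimes> y1"] by simp
  have "y2 \<noteq> c \<otimes> y1" if "c \<in> F" for c
    using that tF y2t nz car t by (metis F_carrier m_rcancel)
  then obtain \<alpha> \<beta> where ab: "\<alpha> \<in> F" "\<beta> \<in> F" "y3 = \<alpha> \<otimes> y2 \<oplus> \<beta> \<otimes> y1"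
    using plane_combination[OF u y(2) y(1) y(3) nz(3)] by blast
  have ac: "\<alpha> \<in> carrier L" "\<beta> \<in> carrier L" using ab by auto
  \<comment> \<open>As \<open>x1 = t x2\<close> and \<open>y2 = t y1\<close>, the difference \<open>x3 y3 - x1 y1\<close> is \<open>x2 y1\<close> times a quadratic
    polynomial in \<open>t\<close>.\<close>
  have "((p \<otimes> \<alpha>) \<otimes> (t \<otimes> t) \<oplus> (p \<otimes> \<beta> \<oplus> r \<otimes> \<alpha> \<ominus> \<one>) \<otimes> t \<oplus> r \<otimes> \<beta>) \<otimes> (x2 \<otimes> y1) =
    (p \<otimes> (t \<otimes> x2) \<oplus> r \<otimes> x2) \<otimes> (\<alpha> \<otimes> (t \<otimes> y1) \<oplus> \<beta> \<otimes> y1) \<ominus> (t \<otimes> x2) \<otimes> y1"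
    using car pc ac t by (simp add: expand)
  also have "\<dots> = x3 \<otimes> y3 \<ominus> x1 \<otimes> y1" using pr(3) ab(3) x1t y2t by simp
  also have "\<dots> = \<zero>" using xy w by simp
  finally have "(p \<otimes> \<alpha>) \<otimes> (t \<otimes> t) \<oplus> (p \<otimes> \<beta> \<oplus> r \<otimes> \<alpha> \<ominus> \<one>) \<otimes> t \<oplus> r \<otimes> \<beta> = \<zero>"
    using nz car t pc ac integral_iff by (auto simp: a_minus_def)
  then have "p \<otimes> \<alpha> = \<zero> \<and> (p \<otimes> \<beta> \<oplus> r \<otimes> \<alpha> \<ominus> \<one>) = \<zero> \<and> r \<otimes> \<beta> = \<zero>"
    using pr ab by (intro quadratic_relation[OF t tF]) auto
  then have "\<alpha> = \<zero>" "\<beta> = \<zero>" using pr0 pc ac integral_iff by auto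
  then show False using ab car nz by simp
qed

end

section \<open>Discrete logarithms modulo the subfield\<close>

text \<open>A cubic extension with a generator \<open>\<theta>\<close> of the multiplicative group of \<open>L\<close>.\<close>

locale singer_setting = finite_cubic_extension +
  fixes \<theta> :: 'a
  assumes theta_mult_of: "\<theta> \<in> carrier (mult_of L)"
    and theta_gen: "generate (mult_of L) {\<theta>} = carrier (mult_of L)"
begin

text \<open>The index of the multiplicative group of \<open>F\<close> in that of \<open>L\<close>, and the modulus of the Singer
  sets.\<close>

definition n :: nat where "n = q\<^sup>2 + q + 1"

lemma n_gt_1: "n > 1" and n_pos [simp]: "n > 0"
  using q_pos by (auto simp: n_def)

lemma theta_carrier [simp]: "\<theta> \<in> carrier L"
  using theta_mult_of by simp

lemma cube_minus_one: "q ^ 3 - 1 = n * (q - 1)"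
proof -
  obtain r where "q = Suc r" using q_pos by (cases q) auto
  then show ?thesis
    unfolding n_def
    by (simp add: power2_eq_square power3_eq_cube algebra_simps)
qed

sublocale M: group "mult_of L" by (rule field_mult_group)

lemma order_M: "order (mult_of L) = q ^ 3 - 1"
  using finite_L card_L by (simp add: order_mult_of order_def)

lemma order_theta: "M.ord \<theta> = q ^ 3 - 1"
  using M.generate_pow_card[OF theta_mult_of] theta_gen order_M by (simp add: order_def)

lemma theta_pow_eq_one: "\<theta> [^] (e::nat) = \<one> \<longleftrightarrow> q ^ 3 - 1 dvd e"
  using M.pow_eq_id[OF theta_mult_of, of e] order_theta by (simp add: nat_pow_mult_of)

lemma theta_pow_nz [simp]: "\<theta> [^] (e::nat) \<noteq> \<zero>"
  using M.nat_pow_closed[OF theta_mult_of, of e] by (simp add: nat_pow_mult_of)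

lemma cube_minus_one_pos: "q ^ 3 - 1 > 0"
  unfolding cube_minus_one using q_ge_2 by simp

text \<open>Exponents range over \<open>{1..q\<^sup>3 - 1}\<close>, as in the definition of the Singer exponents; so \<open>\<one>\<close> has
  exponent \<open>q\<^sup>3 - 1\<close> rather than 0.\<close>

lemma theta_pow_surj:
  assumes "x \<in> carrier L" "x \<noteq> \<zero>"
  obtains e where "e \<in> {1..q ^ 3 - 1}" "\<theta> [^] e = x"
proof -
  have "x \<in> {\<theta> [^]\<^bsub>mult_of L\<^esub> k |k. k \<in> (UNIV :: nat set)}"
    using assms theta_gen M.generate_pow_on_finite_carrier[OF _ theta_mult_of] finite_L by auto
  then obtain k :: nat where k: "x = \<theta> [^] k" by (auto simp: nat_pow_mult_of)
  define N where "N = q ^ 3 - 1"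
  have N: "\<theta> [^] N = \<one>" by (simp add: theta_pow_eq_one N_def)
  have "\<theta> [^] (N * (k div N)) = \<one>" by (simp add: theta_pow_eq_one N_def)
  then have "\<theta> [^] (k mod N) = \<theta> [^] (N * (k div N)) \<otimes> \<theta> [^] (k mod N)" by simp
  also have "\<dots> = \<theta> [^] (N * (k div N) + k mod N)" by (simp only: nat_pow_mult theta_carrier)
  finally have kN: "\<theta> [^] (k mod N) = x" by (simp add: k)
  have "N > 0" using cube_minus_one_pos by (simp add: N_def)
  then have "k mod N < N" by simp
  show ?thesis
  proof (cases "k mod N = 0")
    case True
    then show ?thesis using that[of N] kN N \<open>N > 0\<close> by (simp add: N_def)
  next
    case False
    then show ?thesis using that[of "k mod N"] kN \<open>k mod N < N\<close> by (simp add: N_def)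
  qed
qed

lemma theta_pow_in_F: "\<theta> [^] (e::nat) \<in> F \<longleftrightarrow> n dvd e"
proof -
  have F_pow: "n dvd e" if "\<theta> [^] e \<in> F" for e :: nat
  proof -
    have "(\<theta> [^] e) [^]\<^bsub>mult_of L\<^esub> card (F - {\<zero>}) = \<one>\<^bsub>mult_of L\<^esub>"
      using that by (intro M.pow_card_subgroup subgroup_mult_of subfield) auto
    then have "\<theta> [^] (e * (q - 1)) = \<one>"
      using finite_F card_F by (simp add: nat_pow_mult_of nat_pow_pow)
    then have "n * (q - 1) dvd e * (q - 1)" by (simp only: theta_pow_eq_one cube_minus_one)
    then show ?thesis using q_ge_2 by simp
  qed
  \<comment> \<open>For the converse, \<open>F - {\<zero>}\<close> is contained in the set of the \<open>\<theta> ^ (n j)\<close> with \<open>1 \<le> j < q\<close>,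
    which has no more elements; hence the two sets agree.\<close>
  define A where "A = (\<lambda>j. \<theta> [^] (n * j)) ` {1..q - 1}"
  have "F - {\<zero>} \<subseteq> A"
  proof
    fix x assume x: "x \<in> F - {\<zero>}"
    then obtain e where e: "e \<in> {1..q ^ 3 - 1}" "\<theta> [^] e = x" using theta_pow_surj[of x] by auto
    then obtain j where j: "e = n * j" using x F_pow[of e] by auto
    then have "j \<in> {1..q - 1}" using e(1) unfolding cube_minus_one by auto
    then show "x \<in> A" using e j by (auto simp: A_def)
  qed
  moreover have "card A \<le> card (F - {\<zero>})"
  proof -
    have "card A \<le> card {1..q - 1}" unfolding A_def by (intro card_image_le) simp
    then show ?thesis using finite_F card_F by simp
  qed
  ultimately have FA: "F - {\<zero>} = A" by (intro card_seteq) (auto simp: A_def)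
  have "\<theta> [^] e \<in> F" if "n dvd e" for e
  proof -
    have "q - 1 \<ge> 1" using q_ge_2 by simp
    then have "\<theta> [^] (n * 1) \<in> A" unfolding A_def by (intro imageI) simp
    then have *: "\<theta> [^] n \<in> F" using FA by auto
    from that obtain j where "e = n * j" by (rule dvdE)
    moreover have "(\<theta> [^] n) [^] j \<in> F" for j :: nat
      using * by (induction j) auto
    ultimately show ?thesis by (simp add: nat_pow_pow)
  qed
  then show ?thesis using F_pow by blast
qed

lemma theta_pow_proportional:
  "(\<exists>c\<in>F. \<theta> [^] a = c \<otimes> \<theta> [^] b) \<longleftrightarrow> [a = b] (mod n)"
proof -
  have le: "(\<exists>c\<in>F. \<theta> [^] a = c \<otimes> \<theta> [^] b) \<longleftrightarrow> [a = b] (mod n)" if "b \<le> a" for a b :: nat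
  proof -
    have ab: "\<theta> [^] a = \<theta> [^] (a - b) \<otimes> \<theta> [^] b" using that by (simp add: nat_pow_mult)
    have "(\<exists>c\<in>F. \<theta> [^] a = c \<otimes> \<theta> [^] b) \<longleftrightarrow> \<theta> [^] (a - b) \<in> F"
      unfolding ab by (auto simp: m_rcancel)
    also have "\<dots> \<longleftrightarrow> [a = b] (mod n)"
      using that by (auto simp: theta_pow_in_F cong_altdef_nat)
    finally show ?thesis .
  qed
  have sym: "\<exists>c\<in>F. \<theta> [^] b = c \<otimes> \<theta> [^] a" if "c \<in> F" "\<theta> [^] a = c \<otimes> \<theta> [^] b" for a b :: nat and c
  proof -
    have "c \<noteq> \<zero>" using that by (metis l_null nat_pow_closed theta_carrier theta_pow_nz)
    then have "\<theta> [^] b = inv c \<otimes> \<theta> [^] a"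
      using that divide_left[of c "\<theta> [^] b"] by simp
    then show ?thesis using that \<open>c \<noteq> \<zero>\<close> by blast
  qed
  show ?thesis using le[of a b] le[of b a] sym[of _ a b] sym[of _ b a] cong_sym_eq[of a b n]
    by (metis linear)
qed

text \<open>The discrete logarithm to base \<open>\<theta>\<close> modulo \<open>n\<close>, as an integer in \<open>{0..<n}\<close>. It does not depend
  on the chosen exponent (\<open>dlog_theta_pow\<close>); its value at 0 is arbitrary and plays no role.\<close>

definition dlog :: "'a \<Rightarrow> int" where
  "dlog x = int ((SOME e. \<theta> [^] (e::nat) = x) mod n)"

lemma dlog_theta_pow: "dlog (\<theta> [^] e) = int (e mod n)"
proof -
  define e' where "e' = (SOME e'. \<theta> [^] (e'::nat) = \<theta> [^] e)"
  have "\<theta> [^] e' = \<theta> [^] e" unfolding e'_def by (rule someI) (rule refl)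
  then have "\<theta> [^] e' = \<one> \<otimes> \<theta> [^] e" by simp
  then have "[e' = e] (mod n)" using theta_pow_proportional[of e' e] F_closed(2) by blast
  then show ?thesis by (simp add: dlog_def e'_def cong_def)
qed

lemma dlog_range: "dlog x \<in> {0..<int n}"
  by (simp add: dlog_def)

lemma dlog_one: "dlog \<one> = 0"
  using dlog_theta_pow[of 0] by simp

lemma dlog_eq_iff:
  assumes "x \<in> carrier L" "x \<noteq> \<zero>" "y \<in> carrier L" "y \<noteq> \<zero>"
  shows "dlog x = dlog y \<longleftrightarrow> (\<exists>c\<in>F. x = c \<otimes> y)"
proof -
  obtain a where a: "\<theta> [^] (a :: nat) = x" using theta_pow_surj assms(1,2) .
  obtain b where b: "\<theta> [^] (b :: nat) = y" using theta_pow_surj assms(3,4) .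
  have "dlog x = dlog y \<longleftrightarrow> [a = b] (mod n)"
    unfolding a[symmetric] b[symmetric] dlog_theta_pow by (simp add: cong_def)
  then show ?thesis
    unfolding theta_pow_proportional[symmetric] a b .
qed

lemma dlog_mult:
  assumes "x \<in> carrier L" "x \<noteq> \<zero>" "y \<in> carrier L" "y \<noteq> \<zero>"
  shows "dlog (x \<otimes> y) = (dlog x + dlog y) mod int n"
proof -
  obtain a where a: "\<theta> [^] (a :: nat) = x" using theta_pow_surj assms(1,2) .
  obtain b where b: "\<theta> [^] (b :: nat) = y" using theta_pow_surj assms(3,4) .
  have "x \<otimes> y = \<theta> [^] (a + b)" by (simp add: a[symmetric] b[symmetric] nat_pow_mult)
  then show ?thesis by (simp add: a[symmetric] b[symmetric] dlog_theta_pow zmod_int mod_add_eq)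
qed

section \<open>Singer sets\<close>

text \<open>The element \<open>k\<^sub>2 \<theta>\<^sup>2 + k\<^sub>1 \<theta>\<close> attached to a pair \<open>k = (k\<^sub>1, k\<^sub>2)\<close>.\<close>

definition direction :: "'a \<times> 'a \<Rightarrow> 'a" where
  "direction k = snd k \<otimes> (\<theta> \<otimes> \<theta>) \<oplus> fst k \<otimes> \<theta>"

lemma direction_carrier: "k \<in> F \<times> F \<Longrightarrow> direction k \<in> carrier L"
  by (auto simp: direction_def)

lemma theta_notin_F: "\<theta> \<notin> F"
  using theta_pow_in_F[of 1] n_gt_1 by auto

lemma direction_in_F_iff:
  assumes k: "k \<in> F \<times> F"
  shows "direction k \<in> F \<longleftrightarrow> k = (\<zero>, \<zero>)"
proof
  assume *: "direction k \<in> F"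
  have "snd k \<otimes> (\<theta> \<otimes> \<theta>) \<oplus> fst k \<otimes> \<theta> \<oplus> (\<ominus> direction k) = \<zero>"
    using direction_carrier[OF k] unfolding direction_def by (rule r_neg)
  then show "k = (\<zero>, \<zero>)"
    using quadratic_relation[of \<theta> "snd k" "fst k" "\<ominus> direction k"] theta_notin_F k *
    by (auto simp: prod_eq_iff)
qed (auto simp: direction_def)

text \<open>The element 0 of a Singer set is the logarithm of \<open>\<one>\<close>. The translate \<open>v\<^sub>k + F\<close> contains zero only
  for \<open>k = (0, 0)\<close>, where \<open>\<zero>\<close> has to be removed.\<close>

lemma Singer_single_eq:
  assumes k: "k \<in> F \<times> F"
  shows "Singer_single L F q \<theta> k = insert 0 (dlog ` ((\<lambda>u. direction k \<oplus> u) ` F - {\<zero>}))"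
proof -
  define T where "T = Singer_exponents L F q \<theta> k"
  have "Singer_single L F q \<theta> k = (\<lambda>a. dlog (\<theta> [^] a)) ` T"
  proof -
    interpret Z: residues "int n" "residue_ring (int n)"
      using n_gt_1 by unfold_locales auto
    show ?thesis
      unfolding Singer_single_def T_def n_def[symmetric] Z.res_carrier_eq dlog_theta_pow
      by (auto simp: cong_def zmod_int)
  qed
  also have "\<dots> = dlog ` ((\<lambda>a. \<theta> [^] a) ` T)" by (simp add: image_image)
  also have "(\<lambda>a. \<theta> [^] a) ` T = insert \<one> ((\<lambda>u. direction k \<oplus> u) ` F - {\<zero>})"
  proof -
    have kc: "fst k \<in> carrier L" "snd k \<in> carrier L" using k by auto
    have mem: "x \<ominus> snd k \<otimes> (\<theta> [^] (2::nat)) \<ominus> fst k \<otimes> \<theta> \<in> F \<longleftrightarrow> x \<in> (\<lambda>u. direction k \<oplus> u) ` F"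
      (is "?d \<in> F \<longleftrightarrow> _") if x: "x \<in> carrier L" for x
    proof -
      have "?d = x \<ominus> direction k"
        using x kc by (simp add: direction_def numeral_2_eq_2 a_minus_def minus_add a_ac)
      moreover have "x = direction k \<oplus> (x \<ominus> direction k)"
        using x direction_carrier[OF k] by (simp add: a_minus_def a_ac r_neg r_neg2)
      moreover have "direction k \<oplus> u \<ominus> direction k = u" if "u \<in> F" for u
        using that direction_carrier[OF k] by (simp add: a_minus_def a_comm[of _ u] a_assoc r_neg)
      ultimately show ?thesis by auto
    qed
    have "T = {0} \<union> {a \<in> {1..q ^ 3 - 1}. \<theta> [^] a \<in> (\<lambda>u. direction k \<oplus> u) ` F}"
      using mem by (cases k) (auto simp: T_def Singer_exponents_def)
    moreover have "(\<lambda>u. direction k \<oplus> u) ` F - {\<zero>} = (\<lambda>a. \<theta> [^] a) `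
        {a \<in> {1..q ^ 3 - 1}. \<theta> [^] a \<in> (\<lambda>u. direction k \<oplus> u) ` F}"
      (is "?X = ?Y")
    proof
      show "?X \<subseteq> ?Y"
      proof
        fix x assume x: "x \<in> ?X"
        then have "x \<in> carrier L" "x \<noteq> \<zero>" using direction_carrier[OF k] by auto
        then obtain e where "e \<in> {1..q ^ 3 - 1}" "\<theta> [^] e = x" by (rule theta_pow_surj)
        then show "x \<in> ?Y" using x by blast
      qed
      show "?Y \<subseteq> ?X"
      proof
        fix x assume x: "x \<in> ?Y"
        then obtain e where "x = \<theta> [^] (e :: nat)" by blast
        then show "x \<in> ?X" using x theta_pow_nz[of e] by auto
      qed
    qed
    ultimately show ?thesis by (simp add: image_Un)
  qed
  finally show ?thesis by (simp add: dlog_one)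
qed

lemma Singer_single_range:
  assumes "k \<in> F \<times> F"
  shows "Singer_single L F q \<theta> k \<subseteq> {0..<int n}"
  unfolding Singer_single_eq[OF assms] using dlog_range by auto

lemma Singer_single_plane:
  assumes k: "k \<in> F \<times> F" and s: "s \<in> Singer_single L F q \<theta> k"
  obtains x where "x \<in> plane (direction k)" "x \<noteq> \<zero>" "dlog x = s"
proof -
  have "\<one> \<in> plane (direction k)"
    using planeI[of \<one> \<zero> "direction k"] direction_carrier[OF k] by simp
  moreover have "direction k \<oplus> u \<in> plane (direction k)" if "u \<in> F" for u
    using planeI[of u \<one> "direction k"] that direction_carrier[OF k] by (simp add: a_comm)
  ultimately show ?thesis
    using s that dlog_one one_not_zero unfolding Singer_single_eq[OF k] by auto
qed

text \<open>A representation of \<open>dlog w\<close> as a sum lifts to a factorization of \<open>w\<close> itself: the product of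
  any lifts is proportional to \<open>w\<close>, and the factor from \<open>F\<close> is absorbed into the second one.\<close>

lemma Singer_factorization:
  assumes kl: "k \<in> F \<times> F" "l \<in> F \<times> F"
    and s: "s1 \<in> Singer_single L F q \<theta> k" "s2 \<in> Singer_single L F q \<theta> l"
    and w: "w \<in> carrier L" "w \<noteq> \<zero>" "dlog w = (s1 + s2) mod int n"
  obtains x y where "x \<in> plane (direction k)" "y \<in> plane (direction l)" "x \<otimes> y = w" "dlog x = s1"
proof -
  obtain x where x: "x \<in> plane (direction k)" "x \<noteq> \<zero>" "dlog x = s1"
    using Singer_single_plane[OF kl(1) s(1)] .
  obtain y where y: "y \<in> plane (direction l)" "y \<noteq> \<zero>" "dlog y = s2"
    using Singer_single_plane[OF kl(2) s(2)] .
  have car: "x \<in> carrier L" "y \<in> carrier L"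
    using x y plane_carrier direction_carrier kl by blast+
  have "dlog w = dlog (x \<otimes> y)" using dlog_mult[OF car(1) x(2) car(2) y(2)] x y w by simp
  then obtain c where c: "c \<in> F" "w = c \<otimes> (x \<otimes> y)"
    using dlog_eq_iff[OF w(1,2), of "x \<otimes> y"] car x y integral_iff by auto
  have "x \<otimes> (c \<otimes> y) = w" using c car by (simp add: m_ac)
  moreover have "c \<otimes> y \<in> plane (direction l)"
    using plane_scale[OF direction_carrier[OF kl(2)] c(1) y(1)] .
  ultimately show ?thesis using that x by blast
qed

lemma card_Singer_pairs_le_2:
  fixes m :: int
  assumes kl: "k \<in> F \<times> F" "l \<in> F \<times> F"
  defines "A \<equiv> {(s1, s2). s1 \<in> Singer_single L F q \<theta> k \<and> s2 \<in> Singer_single L F q \<theta> l \<and>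
    (s1 + s2) mod int n = m}"
  shows "finite A \<and> card A \<le> 2"
proof -
  have "A \<subseteq> {0..<int n} \<times> {0..<int n}"
    unfolding A_def using Singer_single_range[OF kl(1)] Singer_single_range[OF kl(2)] by blast
  then have fin: "finite A" by (rule finite_subset) simp
  have inj: "inj_on fst A"
  proof (rule inj_onI)
    fix p p' assume "p \<in> A" "p' \<in> A" "fst p = fst p'"
    then obtain s t t' where p: "p = (s, t)" "p' = (s, t')" and *: "(s, t) \<in> A" "(s, t') \<in> A"
      by (metis prod.collapse)
    then have "(s + t) mod int n = (s + t') mod int n" by (auto simp: A_def)
    then have "t mod int n = t' mod int n"
      by (metis cong_def cong_add_lcancel)
    moreover have "t \<in> {0..<int n}" "t' \<in> {0..<int n}"
      using * Singer_single_range[OF kl(2)] by (auto simp: A_def)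
    ultimately show "p = p'" by (simp add: p)
  qed
  \<comment> \<open>Three pairs with distinct first entries give three factorizations with nonproportional
    first factors.\<close>
  have "card (fst ` A) \<le> 2"
  proof (rule ccontr)
    assume "\<not> card (fst ` A) \<le> 2"
    then have "3 \<le> card (fst ` A)" by simp
    then obtain B where B: "B \<subseteq> fst ` A" "card B = 3" "finite B"
      by (rule obtain_subset_with_card_n)
    obtain s1 s2 s3 where dist: "B = {s1, s2, s3}" "s1 \<noteq> s2" "s3 \<noteq> s1" "s3 \<noteq> s2"
      using B(2) unfolding card_3_iff by metis
    then obtain t1 t2 t3 where A: "(s1, t1) \<in> A" "(s2, t2) \<in> A" "(s3, t3) \<in> A"
      using B(1) by (auto simp: image_iff)
    have m: "0 \<le> m" "m < int n" using A(1) by (auto simp: A_def)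
    then obtain e where e: "m = int e" by (metis nonneg_int_cases)
    define w where "w = \<theta> [^] e"
    have "dlog w = m" using m by (simp add: w_def dlog_theta_pow e)
    have w: "w \<in> carrier L" "w \<noteq> \<zero>" by (auto simp: w_def)
    have fact: "\<exists>x y. x \<in> plane (direction k) \<and> y \<in> plane (direction l) \<and> x \<otimes> y = w \<and> dlog x = s"
      if "(s, t) \<in> A" for s t
    proof -
      have st: "s \<in> Singer_single L F q \<theta> k" "t \<in> Singer_single L F q \<theta> l"
        "dlog w = (s + t) mod int n" using that \<open>dlog w = m\<close> by (auto simp: A_def)
      show ?thesis using Singer_factorization[OF kl st(1,2) w st(3)] by blast
    qed
    obtain x1 y1 where 1: "x1 \<in> plane (direction k)" "y1 \<in> plane (direction l)" "x1 \<otimes> y1 = w" "dlog x1 = s1"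
      using fact[OF A(1)] by blast
    obtain x2 y2 where 2: "x2 \<in> plane (direction k)" "y2 \<in> plane (direction l)" "x2 \<otimes> y2 = w" "dlog x2 = s2"
      using fact[OF A(2)] by blast
    obtain x3 y3 where 3: "x3 \<in> plane (direction k)" "y3 \<in> plane (direction l)" "x3 \<otimes> y3 = w" "dlog x3 = s3"
      using fact[OF A(3)] by blast
    have car: "x \<in> carrier L" "y \<in> carrier L"
      if "x \<in> plane (direction k)" "y \<in> plane (direction l)" for x y
      using that plane_carrier direction_carrier kl by blast+
    have nz: "x \<noteq> \<zero>" if "x \<otimes> y = w" "y \<in> plane (direction l)" for x y
      using that car(2)[OF 1(1)] w(2) by auto
    have nz: "x1 \<noteq> \<zero>" "x2 \<noteq> \<zero>" "x3 \<noteq> \<zero>"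
      using nz[OF 1(3,2)] nz[OF 2(3,2)] nz[OF 3(3,2)] by auto
    have nonprop: "x \<noteq> c \<otimes> x'" if "c \<in> F" "x \<in> plane (direction k)" "x' \<in> plane (direction k)"
      "x \<noteq> \<zero>" "x' \<noteq> \<zero>" "dlog x \<noteq> dlog x'" for x x' c
      using that dlog_eq_iff[of x x'] car(1)[OF _ 1(2)] by blast
    show False
    proof (rule no_three_factorizations[OF direction_carrier[OF kl(1)] direction_carrier[OF kl(2)] w
          1(1) 2(1) 3(1) 1(2) 2(2) 3(2) 1(3) 2(3) 3(3)])
      fix c assume c: "c \<in> F"
      show "x1 \<noteq> c \<otimes> x2" using nonprop[OF c 1(1) 2(1)] nz dist 1(4) 2(4) by auto
      show "x3 \<noteq> c \<otimes> x1" using nonprop[OF c 3(1) 1(1)] nz dist 1(4) 3(4) by auto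
      show "x3 \<noteq> c \<otimes> x2" using nonprop[OF c 3(1) 2(1)] nz dist 2(4) 3(4) by auto
    qed
  qed
  then show ?thesis using fin inj by (simp add: card_image)
qed

lemma Singer_range:
  assumes "\<K> \<subseteq> F \<times> F"
  shows "Singer L F q \<theta> \<K> \<subseteq> {0..<int n}"
proof -
  have "Singer_single L F q \<theta> k \<subseteq> {0..<int n}" if "k \<in> \<K>" for k
    using Singer_single_range that assms by blast
  then show ?thesis unfolding Singer_def by blast
qed

lemma self_conv_Singer_le:
  assumes K: "\<K> \<subseteq> F \<times> F"
  shows "self_conv n (Singer L F q \<theta> \<K>) m \<le> 2 * (card \<K>)\<^sup>2"
proof -
  interpret Z: residues "int n" "residue_ring (int n)"
    using n_gt_1 by unfold_locales auto
  have finK: "finite \<K>" using K finite_F finite_cartesian_product finite_subset by blast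
  define A where "A = (\<lambda>(k, l). {(s1, s2). s1 \<in> Singer_single L F q \<theta> k \<and>
    s2 \<in> Singer_single L F q \<theta> l \<and> (s1 + s2) mod int n = m})"
  have "self_conv n (Singer L F q \<theta> \<K>) m = card (\<Union>p\<in>\<K> \<times> \<K>. A p)"
  proof -
    have "{(s1, s2). s1 \<in> Singer L F q \<theta> \<K> \<and> s2 \<in> Singer L F q \<theta> \<K> \<and> (s1 + s2) mod int n = m} =
        (\<Union>p\<in>\<K> \<times> \<K>. A p)"
      unfolding A_def Singer_def by blast
    then show ?thesis by (simp only: self_conv_def Z.res_add_eq)
  qed
  also have "\<dots> \<le> (\<Sum>p\<in>\<K> \<times> \<K>. card (A p))"
    using finK by (intro card_UN_le) simp
  also have "\<dots> \<le> (\<Sum>p\<in>\<K> \<times> \<K>. 2)"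
  proof (rule sum_mono)
    fix p assume "p \<in> \<K> \<times> \<K>"
    then obtain k l where p: "p = (k, l)" "k \<in> F \<times> F" "l \<in> F \<times> F" using K by blast
    show "card (A p) \<le> 2"
      using card_Singer_pairs_le_2[OF p(2,3), of m] by (simp add: A_def p(1))
  qed
  also have "\<dots> = 2 * (card \<K>)\<^sup>2"
    by (simp add: card_cartesian_product power2_eq_square)
  finally show ?thesis .
qed

lemma card_Singer:
  assumes K: "\<K> \<subseteq> F \<times> F" "\<K> \<noteq> {}" "(\<zero>, \<zero>) \<notin> \<K>"
    and indep: "\<And>k l c. k \<in> \<K> \<Longrightarrow> l \<in> \<K> \<Longrightarrow> c \<in> F \<Longrightarrow>
      fst k = c \<otimes> fst l \<Longrightarrow> snd k = c \<otimes> snd l \<Longrightarrow> k = l"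
  shows "card (Singer L F q \<theta> \<K>) = card \<K> * q + 1"
proof -
  have finK: "finite \<K>" using K(1) finite_F finite_cartesian_product finite_subset by blast
  define g where "g = (\<lambda>(k, u). direction k \<oplus> u)"
  \<comment> \<open>No \<open>v\<^sub>k + u\<close> is proportional to \<open>\<one>\<close>, so 0 arises only from the exponent 0.\<close>
  have gnF: "g p \<notin> F" if "p \<in> \<K> \<times> F" for p
  proof
    obtain k u where p: "p = (k, u)" "k \<in> \<K>" "u \<in> F" using \<open>p \<in> \<K> \<times> F\<close> by auto
    assume "g p \<in> F"
    then have "(direction k \<oplus> u) \<ominus> u \<in> F" using p by (auto simp: g_def)
    moreover have "(direction k \<oplus> u) \<ominus> u = direction k"
      using p K direction_carrier[of k] by (auto simp: a_minus_def a_assoc r_neg)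
    ultimately have "k = (\<zero>, \<zero>)" using direction_in_F_iff[of k] p K by auto
    then show False using p K by auto
  qed
  have gc: "g p \<in> carrier L" "g p \<noteq> \<zero>" if "p \<in> \<K> \<times> F" for p
    using that K direction_carrier gnF[OF that] by (auto simp: g_def)
  have S: "Singer L F q \<theta> \<K> = insert 0 (dlog ` g ` (\<K> \<times> F))"
  proof -
    have "(\<Union>k\<in>\<K>. Singer_single L F q \<theta> k) = (\<Union>k\<in>\<K>. insert 0 (dlog ` (\<lambda>u. g (k, u)) ` F))"
    proof (intro SUP_cong refl)
      fix k assume k: "k \<in> \<K>"
      have "(\<lambda>u. g (k, u)) ` F - {\<zero>} = (\<lambda>u. g (k, u)) ` F"
        using gc(2)[of "(k, _)"] k by force
      then show "Singer_single L F q \<theta> k = insert 0 (dlog ` (\<lambda>u. g (k, u)) ` F)"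
        using Singer_single_eq[of k] k K by (auto simp: g_def)
    qed
    then show ?thesis using K(2) by (auto simp: Singer_def)
  qed
  have "0 \<notin> dlog ` g ` (\<K> \<times> F)"
  proof
    assume "0 \<in> dlog ` g ` (\<K> \<times> F)"
    then obtain p where p: "p \<in> \<K> \<times> F" "dlog (g p) = dlog \<one>" by (auto simp: dlog_one)
    then obtain c where "c \<in> F" "g p = c \<otimes> \<one>" using dlog_eq_iff[of "g p" \<one>] gc[of p] by auto
    then show False using gnF[OF p(1)] by auto
  qed
  moreover have "inj_on (dlog \<circ> g) (\<K> \<times> F)"
  proof (rule inj_onI)
    fix p p' assume p: "p \<in> \<K> \<times> F" "p' \<in> \<K> \<times> F" "(dlog \<circ> g) p = (dlog \<circ> g) p'"
    obtain c where c: "c \<in> F" "g p = c \<otimes> g p'"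
      using p dlog_eq_iff[of "g p" "g p'"] gc by auto
    obtain k1 k2 u l1 l2 u' where pp: "p = ((k1, k2), u)" "p' = ((l1, l2), u')"
      by (metis surj_pair)
    have F: "k1 \<in> F" "k2 \<in> F" "u \<in> F" "l1 \<in> F" "l2 \<in> F" "u' \<in> F" using p pp K by auto
    have car: "k1 \<in> carrier L" "k2 \<in> carrier L" "u \<in> carrier L" "l1 \<in> carrier L"
      "l2 \<in> carrier L" "u' \<in> carrier L" "c \<in> carrier L" "\<theta> \<in> carrier L" using F c by auto
    \<comment> \<open>The proportionality is a quadratic relation for \<open>\<theta>\<close> over \<open>F\<close>.\<close>
    have "(k2 \<ominus> c \<otimes> l2) \<otimes> (\<theta> \<otimes> \<theta>) \<oplus> (k1 \<ominus> c \<otimes> l1) \<otimes> \<theta> \<oplus> (u \<ominus> c \<otimes> u') = g p \<ominus> c \<otimes> g p'"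
      using car by (simp add: pp g_def direction_def expand)
    also have "\<dots> = \<zero>" using c car by (simp add: pp g_def direction_def)
    finally have "k2 \<ominus> c \<otimes> l2 = \<zero> \<and> k1 \<ominus> c \<otimes> l1 = \<zero> \<and> u \<ominus> c \<otimes> u' = \<zero>"
      using F c theta_notin_F by (intro quadratic_relation[of \<theta>]) auto
    then have eqs: "k2 = c \<otimes> l2" "k1 = c \<otimes> l1" "u = c \<otimes> u'" using car by auto
    then have kl: "k1 = l1" "k2 = l2" using indep[of "(k1, k2)" "(l1, l2)" c] p pp c by auto
    have "l1 \<noteq> \<zero> \<or> l2 \<noteq> \<zero>" using p pp K by auto
    then have "c = \<one>" using eqs kl car m_rcancel[of l1 c \<one>] m_rcancel[of l2 c \<one>] by auto
    then show "p = p'" using pp kl eqs car by simp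
  qed
  then have "card (dlog ` g ` (\<K> \<times> F)) = card \<K> * q"
    by (simp only: image_comp card_image card_cartesian_product card_F)
  ultimately show ?thesis using finK finite_F by (simp add: S)
qed

end

theorem mainTheorem7:
  fixes L :: "('a, 'b) ring_scheme"
    and F :: "'a set"
    and q :: nat
    and \<theta> :: 'a
    and \<K> :: "('a \<times> 'a) set"
  assumes "primepow q"
    and "field L" and "card (carrier L) = q ^ 3"
    and "subfield F L" and "card F = q"
    and "\<theta> \<in> carrier (mult_of L)"
    and "generate (mult_of L) {\<theta>} = carrier (mult_of L)"
    and "\<K> \<subseteq> F \<times> F"
    and "\<And>k1 k2 l1 l2. (k1, k2) \<in> \<K> \<Longrightarrow> (l1, l2) \<in> \<K> \<Longrightarrow> (k1, k2) \<noteq> (l1, l2) \<Longrightarrow>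
           \<not> (\<exists>c\<in>F. l1 = c \<otimes>\<^bsub>L\<^esub> k1 \<and> l2 = c \<otimes>\<^bsub>L\<^esub> k2)"
  shows "Singer L F q \<theta> \<K> \<subseteq> carrier (residue_ring (int (q\<^sup>2 + q + 1))) \<and>
         (\<K> \<noteq> {} \<and> \<K> \<noteq> {(\<zero>\<^bsub>L\<^esub>, \<zero>\<^bsub>L\<^esub>)} \<longrightarrow>
            card (Singer L F q \<theta> \<K>) = card \<K> * q + 1) \<and>
         self_conv_sup_norm (q\<^sup>2 + q + 1) (Singer L F q \<theta> \<K>) \<le> 2 * (card \<K>)\<^sup>2"
proof -
  have "q > 0" using assms(1) by (rule primepow_gt_0_nat)
  then interpret singer_setting L F q \<theta>
    by (intro singer_setting.intro finite_cubic_extension.intro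
        finite_cubic_extension_axioms.intro singer_setting_axioms.intro assms(2-7))
  interpret Z: residues "int n" "residue_ring (int n)"
    using n_gt_1 by unfold_locales auto
  have car: "carrier (residue_ring (int n)) = {0..<int n}"
    by (auto simp: Z.res_carrier_eq)
  have "Singer L F q \<theta> \<K> \<subseteq> carrier (residue_ring (int n))"
    using Singer_range[OF assms(8)] car by simp
  moreover have "card (Singer L F q \<theta> \<K>) = card \<K> * q + 1"
    if K: "\<K> \<noteq> {}" "\<K> \<noteq> {(\<zero>\<^bsub>L\<^esub>, \<zero>\<^bsub>L\<^esub>)}"
  proof (rule card_Singer[OF assms(8) K(1)])
    \<comment> \<open>The zero pair is a multiple of every other pair.\<close>
    show "(\<zero>\<^bsub>L\<^esub>, \<zero>\<^bsub>L\<^esub>) \<notin> \<K>"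
    proof
      assume zero: "(\<zero>\<^bsub>L\<^esub>, \<zero>\<^bsub>L\<^esub>) \<in> \<K>"
      with K(2) obtain k1 k2 where k: "(k1, k2) \<in> \<K>" "(k1, k2) \<noteq> (\<zero>\<^bsub>L\<^esub>, \<zero>\<^bsub>L\<^esub>)" by auto
      moreover have "k1 \<in> F" "k2 \<in> F" using k assms(8) by auto
      ultimately have "\<exists>c\<in>F. \<zero>\<^bsub>L\<^esub> = c \<otimes>\<^bsub>L\<^esub> k1 \<and> \<zero>\<^bsub>L\<^esub> = c \<otimes>\<^bsub>L\<^esub> k2"
        by (intro bexI[of _ "\<zero>\<^bsub>L\<^esub>"]) auto
      then show False using assms(9)[OF k(1) zero k(2)] by blast
    qed
    fix k l c
    assume kl: "k \<in> \<K>" "l \<in> \<K>"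
      and c: "c \<in> F" "fst k = c \<otimes>\<^bsub>L\<^esub> fst l" "snd k = c \<otimes>\<^bsub>L\<^esub> snd l"
    show "k = l"
    proof (rule ccontr)
      assume "k \<noteq> l"
      then have "\<not> (\<exists>c\<in>F. fst k = c \<otimes>\<^bsub>L\<^esub> fst l \<and> snd k = c \<otimes>\<^bsub>L\<^esub> snd l)"
        using kl by (intro assms(9)) (auto simp: prod_eq_iff)
      then show False using c by blast
    qed
  qed
  moreover have "self_conv_sup_norm n (Singer L F q \<theta> \<K>) \<le> 2 * (card \<K>)\<^sup>2"
  proof -
    have "carrier (residue_ring (int n)) \<noteq> {}" using car n_pos by simp
    then show ?thesis
      unfolding self_conv_sup_norm_def using self_conv_Singer_le[OF assms(8)]
      by (simp add: Max_le_iff)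
  qed
  ultimately show ?thesis by (simp only: n_def) simp
qed

end
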